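(* Let $A \in \mathbb{R}^{n \times n}$, $\boldsymbol{b}, \boldsymbol{x}_0 \in \mathbb{R}^n$, $\boldsymbol{r}_0 = \boldsymbol{b} - A\boldsymbol{x}_0$, and let $k \in \{2,\dots,n-1\}$ be such that $\dim \mathcal{K}_k(A,\boldsymbol{r}_0) = k$. Then the extended Hessenberg matrices $H_{k+1,k}$ of GMRES and $H^{\mathrm{R}}_{k,k-1}$ of RR-GMRES satisfy $$\kappa(H^{\mathrm{R}}_{k,k-1}) \leq \kappa(H_{k+1,k}).$$
   Context: $\|\cdot\|$ is the Euclidean vector norm. For a matrix $M\in\mathbb{R}^{(m+1)\times m}$ with singular values $\sigma_1(M)\ge\dots\ge\sigma_m(M)$, here $\kappa(M) = \sigma_1(M)/\sigma_m(M)$, with $\kappa(M)=+\infty$ if $\sigma_m(M)=0$. For a vector $\boldsymbol{v}$, $\mathcal{K}_j(A,\boldsymbol{v}) = \mathrm{span}\{\boldsymbol{v}, A\boldsymbol{v}, \dots, A^{j-1}\boldsymbol{v}\}$. If $\dim\mathcal{K}_j(A,\boldsymbol{v})=j$, the Arnoldi process with initial vector $\boldsymbol{v}$ gives a decomposition $A Q_j = Q_{j+1} H_{j+1,j}$ with $H_{j+1,j}\in\mathbb{R}^{(j+1)\times j}$ an extended (upper) Hessenberg matrix, where $Q_j = [\boldsymbol{q}_1,\dots,\boldsymbol{q}_j]$ has orthonormal columns with $\boldsymbol{q}_1 = \boldsymbol{v}/\|\boldsymbol{v}\|$ and $\mathrm{span}\{\boldsymbol{q}_1,\dots,\boldsymbol{q}_i\}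 = \mathcal{K}_i(A,\boldsymbol{v})$ for $i\le j$, and $Q_{j+1}=[Q_j,\boldsymbol{q}_{j+1}]$ where $\boldsymbol{q}_{j+1}$ extends this to an orthonormal basis of $\mathcal{K}_{j+1}(A,\boldsymbol{v})$ if that space has dimension $j+1$; if it has dimension $j$, the last row of $H_{j+1,j}$ is zero and $AQ_j = Q_jH_{j,j}$ with $H_{j,j}$ the first $j$ rows. In particular $\|AQ_j\boldsymbol{w}\| = \|H_{j+1,j}\boldsymbol{w}\|$ for all $\boldsymbol{w}\in\mathbb{R}^j$. GMRES uses $\boldsymbol{v}=\boldsymbol{r}_0$, and its matrix with $j=k$ is $H_{k+1,k}$. RR-GMRES (range restricted GMRES, which minimizes the residual over $\boldsymbol{x}_0+\mathcal{K}_j(A,A\boldsymbol{r}_0)$) uses $\boldsymbol{v}=A\boldsymbol{r}_0$, and its matrix with $j=k-1$ is $H^{\mathrm{R}}_{k,k-1}$; it is defined here because $\dim\mathcal{K}_k(A,\boldsymbol{r}_0)=k$ implies $\dim\mathcal{K}_{k-1}(A,A\boldsymbol{r}_0)=k-1$. *)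

theory Defs
  imports
    "HOL-Analysis.Analysis"
    "Jordan_Normal_Form.Char_Poly"
begin

(* In decreasing order and with multiplicity. *)
definition singular_values :: "real mat \<Rightarrow> real list" where
  "singular_values M =
     rev (sorted_list_of_multiset
       (image_mset sqrt (proots (char_poly (transpose_mat M * M)))))"

definition condition_number :: "real mat \<Rightarrow> ereal" where
  "condition_number M =
     (let \<sigma>\<^sub>1 = singular_values M ! 0; \<sigma>\<^sub>m = singular_values M ! (dim_col M - 1)
      in if \<sigma>\<^sub>m = 0 then \<infinity> else ereal (\<sigma>\<^sub>1 / \<sigma>\<^sub>m))"

(* The power is an iterate of the map: on the type real^'n^'n the operation ^ is
   componentwise. *)
definition krylov :: "real^'n^'n \<Rightarrow> real^'n \<Rightarrow> nat \<Rightarrow> (real^'n) set" where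
  "krylov A v j = span ((\<lambda>i. ((*v) A ^^ i) v) ` {..<j})"

definition upper_hessenberg :: "real mat \<Rightarrow> bool" where
  "upper_hessenberg H \<longleftrightarrow>
     (\<forall>i<dim_row H. \<forall>l<dim_col H. l + 1 < i \<longrightarrow> H $$ (i, l) = 0)"

definition orthonormal_family :: "nat \<Rightarrow> (nat \<Rightarrow> real^'n) \<Rightarrow> bool" where
  "orthonormal_family m q \<longleftrightarrow>
     (\<forall>i<m. \<forall>l<m. inner (q i) (q l) = (if i = l then 1 else 0))"

(* Indices start at 0: the columns q_1, ..., q_{j+1} are q 0, ..., q j.  The value q j
   is irrelevant in the breakdown case. *)
definition arnoldi_decomposition ::
  "real^'n^'n \<Rightarrow> real^'n \<Rightarrow> nat \<Rightarrow> (nat \<Rightarrow> real^'n) \<Rightarrow> real mat \<Rightarrow> bool" where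
  "arnoldi_decomposition A v j q H \<longleftrightarrow>
     H \<in> carrier_mat (j + 1) j \<and> upper_hessenberg H \<and>
     q 0 = v /\<^sub>R norm v \<and>
     orthonormal_family j q \<and>
     (\<forall>i\<le>j. span (q ` {..<i}) = krylov A v i) \<and>
     (if dim (krylov A v (j + 1)) = j + 1
      then orthonormal_family (j + 1) q \<and>
           span (q ` {..<j + 1}) = krylov A v (j + 1) \<and>
           (\<forall>l<j. A *v q l = (\<Sum>i<j + 1. H $$ (i, l) *\<^sub>R q i))
      else (\<forall>l<j. H $$ (j, l) = 0) \<and>
           (\<forall>l<j. A *v q l = (\<Sum>i<j. H $$ (i, l) *\<^sub>R q i)))"

lemma real_symmetric_char_poly_splits:
  fixes B :: "real mat"
  assumes B: "B \<in> carrier_mat n n" and sym: "transpose_mat B = B"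
  shows "\<exists>rs. char_poly B = (\<Prod>r\<leftarrow>rs. [:- r, 1:]) \<and> length rs = n"
proof -
  let ?C = "map_mat complex_of_real B"
  have C: "?C \<in> carrier_mat n n" using B by auto
  obtain as where as: "char_poly ?C = (\<Prod>a\<leftarrow>as. [:- a, 1:])" "length as = n"
    using char_poly_factorized[OF C] by blast
  have real: "a \<in> \<real>" if "a \<in> set as" for a
  proof -
    have "poly (char_poly ?C) a = 0"
      unfolding as(1) poly_prod_list prod_list_zero_iff using that by force
    then have "eigenvalue ?C a" using eigenvalue_root_char_poly[OF C] by blast
    then obtain w where w: "w \<in> carrier_vec n" "w \<noteq> 0\<^sub>v n" "?C *\<^sub>v w = a \<cdot>\<^sub>v w"
      unfolding eigenvalue_def eigenvector_def using C by auto
    have cC: "conjugate (?C *\<^sub>v x) = ?C *\<^sub>v conjugate x" if x: "x \<in> carrier_vec n" for x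
    proof (rule eq_vecI)
      fix i assume "i < dim_vec (?C *\<^sub>v conjugate x)"
      then have i: "i < n" using C by auto
      have "conjugate (row ?C i) = row ?C i"
        using i B by (intro eq_vecI) auto
      moreover have "conjugate (row ?C i \<bullet> x) = conjugate (row ?C i) \<bullet> conjugate x"
        by (rule conjugate_sprod_vec[of _ n]) (use i B x in auto)
      ultimately show "conjugate (?C *\<^sub>v x) $ i = (?C *\<^sub>v conjugate x) $ i"
        using i B x by simp
    qed auto
    have sC: "transpose_mat ?C = ?C"
      using sym B by (intro eq_matI) (auto, metis carrier_matD index_transpose_mat(1))
    have "a * (w \<bullet>c w) = (?C *\<^sub>v w) \<bullet> conjugate w"
      using w by simp
    also have "\<dots> = w \<bullet> (?C *\<^sub>v conjugate w)"
      using transpose_vec_mult_scalar[OF C, of "conjugate w" w] w sC by simp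
    also have "\<dots> = w \<bullet> conjugate (a \<cdot>\<^sub>v w)" using cC[OF w(1)] w(3) by simp
    also have "\<dots> = cnj a * (w \<bullet>c w)"
      using w by (simp add: conjugate_smult_vec)
    finally have "a = cnj a" using conjugate_square_eq_0_vec[OF w(1)] w(2) by simp
    then show ?thesis by (metis Reals_cnj_iff)
  qed
  define rs where "rs = map Re as"
  have as_rs: "as = map complex_of_real rs"
    unfolding rs_def using real by (simp add: o_def) (metis (no_types, lifting) list.map_id of_real_Re id_apply map_idI)
  interpret h: map_poly_inj_idom_hom complex_of_real ..
  have "map_poly complex_of_real (char_poly B) = char_poly ?C"
    using of_real_hom.char_poly_hom[OF B] by metis
  also have "\<dots> = map_poly complex_of_real (\<Prod>r\<leftarrow>rs. [:- r, 1:])"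
    unfolding as(1) as_rs
    by (induction rs) (auto simp del: mult_pCons_left simp: h.hom_mult)
  finally have "char_poly B = (\<Prod>r\<leftarrow>rs. [:- r, 1:])"
    by (rule h.injectivity)
  moreover have "length rs = n" using as(2) rs_def by simp
  ultimately show ?thesis by blast
qed

lemma length_singular_values: "length (singular_values M) = dim_col M"
proof -
  let ?n = "dim_col M"
  have M: "M \<in> carrier_mat (dim_row M) ?n" by auto
  have B: "transpose_mat M * M \<in> carrier_mat ?n ?n" using M by auto
  have sym: "transpose_mat (transpose_mat M * M) = transpose_mat M * M"
    using transpose_mult[OF _ M, of "transpose_mat M" ?n] by simp
  obtain rs where rs: "char_poly (transpose_mat M * M) = (\<Prod>r\<leftarrow>rs. [:- r, 1:])" "length rs = ?n"
    using real_symmetric_char_poly_splits[OF B sym] by blast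
  have "proots (\<Prod>r\<leftarrow>rs. [:- r, 1:]) = mset rs" for rs :: "real list"
    proof (induction rs)
    case (Cons r rs)
    have nz: "(\<Prod>r\<leftarrow>rs. [:- r, 1:]) \<noteq> 0" by (auto simp: prod_list_zero_iff)
    have "proots ([:- r, 1:] * (\<Prod>r\<leftarrow>rs. [:- r, 1:])) = {#r#} + mset rs"
      using Cons nz by (subst proots_mult) (simp_all del: mult_pCons_left)
    then show ?case by (simp del: mult_pCons_left)
  qed simp
  with rs have "size (proots (char_poly (transpose_mat M * M))) = ?n" by simp
  then show ?thesis
    unfolding singular_values_def by (metis length_rev size_mset mset_sorted_list_of_multiset size_image_mset)
qed

lemma krylov_0: "krylov A v 0 = {0}" by (simp add: krylov_def)

lemma krylov_Suc: "krylov A v (Suc m) = span (insert (((*v) A ^^ m) v) (krylov A v m))"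
  unfolding krylov_def by (simp add: lessThan_Suc span_insert real_vector.span_span)

lemma krylov_mono: "i \<le> m \<Longrightarrow> krylov A v i \<subseteq> krylov A v m"
  unfolding krylov_def by (intro span_mono) auto

lemma dim_krylov_le: "dim (krylov A v m) \<le> m"
  unfolding krylov_def
  by (metis (no_types, lifting) card_image_le card_lessThan dim_le_card dim_span finite_imageI finite_lessThan le_trans span_superset)

lemma krylov_mult: "x \<in> krylov A v m \<Longrightarrow> A *v x \<in> krylov A v (Suc m)"
proof -
  assume "x \<in> krylov A v m"
  then have "A *v x \<in> (*v) A ` span ((\<lambda>i. ((*v) A ^^ i) v) ` {..<m})" by (auto simp: krylov_def)
  also have "\<dots> = span ((*v) A ` (\<lambda>i. ((*v) A ^^ i) v) ` {..<m})"
    by (simp add: linear_span_image)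
  also have "\<dots> \<subseteq> krylov A v (Suc m)"
    unfolding krylov_def
  proof (intro span_mono, clarsimp)
    fix i assume "i < m"
    then show "A *v ((*v) A ^^ i) v \<in> (\<lambda>i. ((*v) A ^^ i) v) ` {..<Suc m}"
      by (intro image_eqI[of _ _ "Suc i"]) auto
  qed
  finally show ?thesis .
qed

lemma dim_krylov_Suc: "dim (krylov A v (Suc m)) = Suc m \<Longrightarrow> dim (krylov A v m) = m \<and> ((*v) A ^^ m) v \<notin> krylov A v m"
  using dim_krylov_le[of A v m] unfolding krylov_Suc
  by (auto simp: dim_insert krylov_def real_vector.span_span split: if_splits)

lemma orthonormal_family_expansion:
  assumes on: "orthonormal_family m q" and x: "x \<in> span (q ` {..<m})"
  shows "x = (\<Sum>i<m. inner (q i) x *\<^sub>R q i)"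
proof (rule vector_eq_dot_span[OF x])
  show "(\<Sum>i<m. inner (q i) x *\<^sub>R q i) \<in> span (q ` {..<m})"
    by (intro span_sum span_scale span_base) auto
  fix b assume "b \<in> q ` {..<m}"
  then obtain l where l: "l < m" "b = q l" by auto
  have "inner b (\<Sum>i<m. inner (q i) x *\<^sub>R q i) = (\<Sum>i<m. inner (q i) x * (if l = i then 1 else 0))"
    using on l by (auto simp: inner_sum_right orthonormal_family_def intro!: sum.cong)
  also have "\<dots> = inner b x" using l by (simp add: if_distrib[of "(*) _"] sum.delta cong: if_cong)
  finally show "inner b x = inner b (\<Sum>i<m. inner (q i) x *\<^sub>R q i)" by simp
qed

lemma orthonormal_krylov_basis:
  assumes "dim (krylov A v m) = m"
  shows "\<exists>q. q 0 = v /\<^sub>R norm v \<and> orthonormal_family m q \<and> (\<forall>i\<le>m. span (q ` {..<i}) = krylov A v i)"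
  using assms
proof (induction m)
  case 0
  show ?case by (rule exI[of _ "\<lambda>_. v /\<^sub>R norm v"]) (auto simp: orthonormal_family_def krylov_0)
next
  case (Suc m)
  from dim_krylov_Suc[OF Suc.prems] have d: "dim (krylov A v m) = m" "((*v) A ^^ m) v \<notin> krylov A v m" by auto
  from Suc.IH[OF d(1)] obtain q where q: "q 0 = v /\<^sub>R norm v" "orthonormal_family m q"
    "\<And>i. i \<le> m \<Longrightarrow> span (q ` {..<i}) = krylov A v i" by blast
  define u where "u = ((*v) A ^^ m) v"
  define s where "s = (\<Sum>i<m. inner (q i) u *\<^sub>R q i)"
  define w where "w = u - s"
  have s: "s \<in> krylov A v m" unfolding s_def q(3)[OF order.refl, symmetric]
    by (intro span_sum span_scale span_base) auto
  have w0: "w \<noteq> 0" using s d(2) unfolding w_def u_def by auto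
  define q' where "q' = q(m := w /\<^sub>R norm w)"
  have wo: "inner (q l) w = 0" if "l < m" for l
  proof -
    have "inner (q l) s = (\<Sum>i<m. inner (q i) u * (if l = i then 1 else 0))"
      unfolding s_def using q(2) that by (auto simp: inner_sum_right orthonormal_family_def intro!: sum.cong)
    then show ?thesis using that by (simp add: w_def inner_diff_right if_distrib[of "(*) _"] sum.delta cong: if_cong)
  qed
  have ww: "inner (q' m) (q' m) = 1" using w0 by (simp add: q'_def dot_square_norm power2_eq_square)
  have on: "orthonormal_family (Suc m) q'"
    unfolding orthonormal_family_def
  proof (intro allI impI)
    fix i l assume "i < Suc m" "l < Suc m"
    then consider "i < m" "l < m" | "i = m" "l < m" | "i < m" "l = m" | "i = m" "l = m" by linarith
    then show "inner (q' i) (q' l) = (if i = l then 1 else 0)"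
    proof cases
      case 1 then show ?thesis using q(2) by (auto simp: q'_def orthonormal_family_def)
    next
      case 2 then show ?thesis using wo[of l] by (auto simp: q'_def inner_commute)
    next
      case 3 then show ?thesis using wo[of i] by (auto simp: q'_def)
    next
      case 4 then show ?thesis using ww by simp
    qed
  qed
  have im: "q' ` {..<i} = q ` {..<i}" if "i \<le> m" for i using that by (auto simp: q'_def)
  have K: "krylov A v m = span (q ` {..<m})" using q(3)[of m] by simp
  have qm: "q' m = w /\<^sub>R norm w" by (simp add: q'_def)
  have "span (q' ` {..<Suc m}) = span (insert (q' m) (krylov A v m))"
    by (simp add: lessThan_Suc im K span_insert real_vector.span_span)
  also have "\<dots> = span (insert u (krylov A v m))"
  proof (rule span_eq[THEN iffD2], intro conjI)
    have u_in: "u \<in> span (insert u (krylov A v m))" and s_in: "s \<in> span (insert u (krylov A v m))"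
      using s by (auto intro: span_base)
    have "q' m \<in> span (insert u (krylov A v m))"
      unfolding qm w_def by (intro span_scale span_diff u_in s_in)
    then show "insert (q' m) (krylov A v m) \<subseteq> span (insert u (krylov A v m))"
      by (auto intro: span_base)
    have "u = norm w *\<^sub>R q' m + s" using w0 by (simp add: qm w_def)
    moreover have "norm w *\<^sub>R q' m + s \<in> span (insert (q' m) (krylov A v m))"
      using s by (intro span_add span_scale) (auto intro: span_base)
    ultimately show "insert u (krylov A v m) \<subseteq> span (insert (q' m) (krylov A v m))"
      by (auto intro: span_base)
  qed
  finally have sp: "span (q' ` {..<Suc m}) = krylov A v (Suc m)" by (simp add: krylov_Suc u_def)
  have "q' 0 = v /\<^sub>R norm v" using q(1) by (cases "m = 0") (auto simp: q'_def w_def s_def u_def)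
  then show ?case using on sp im q(3) by (intro exI[of _ q']) (auto simp: le_Suc_eq)
qed

lemma arnoldi_decomposition_exists:
  assumes dj: "dim (krylov A v j) = j"
  shows "\<exists>q H. arnoldi_decomposition A v j q H"
proof -
  define m where "m = (if dim (krylov A v (j + 1)) = j + 1 then j + 1 else j)"
  have jm: "j \<le> m" "m \<le> j + 1" by (auto simp: m_def)
  have dm: "dim (krylov A v m) = m" using dj by (auto simp: m_def)
  obtain q where q: "q 0 = v /\<^sub>R norm v" "orthonormal_family m q"
    "\<And>i. i \<le> m \<Longrightarrow> span (q ` {..<i}) = krylov A v i" using orthonormal_krylov_basis[OF dm] by blast
  have Km: "krylov A v m = krylov A v (Suc j)"
  proof (cases "m = j + 1")
    case False
    then have mj: "m = j" and ne: "dim (krylov A v (Suc j)) \<noteq> Suc j" using m_def by (auto split: if_splits)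
    have "((*v) A ^^ j) v \<in> span (krylov A v j)"
    proof (rule ccontr)
      assume "((*v) A ^^ j) v \<notin> span (krylov A v j)"
      then have "dim (krylov A v (Suc j)) = Suc j" using dj by (simp add: krylov_Suc dim_insert)
      then show False using ne by simp
    qed
    then have "span (insert (((*v) A ^^ j) v) (krylov A v j)) = span (krylov A v j)" by (rule span_redundant)
    then show ?thesis using mj by (simp add: krylov_Suc) (simp add: krylov_def real_vector.span_span)
  qed simp
  define H where "H = mat (j + 1) j (\<lambda>(i, l). if i < m then inner (q i) (A *v q l) else 0)"
  have Aq: "A *v q l \<in> krylov A v (Suc (Suc l))" if "l < j" for l
    using that jm by (intro krylov_mult) (auto simp flip: q(3) intro: span_base)
  have hess: "upper_hessenberg H"
    unfolding upper_hessenberg_def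
  proof (intro allI impI)
    fix i l assume il: "i < dim_row H" "l < dim_col H" "l + 1 < i"
    show "H $$ (i, l) = 0"
    proof (cases "i < m")
      case True
      have "A *v q l \<in> span (q ` {..<Suc (Suc l)})" using Aq[of l] il True by (subst q(3)) (auto simp: H_def)
      moreover have "Linear_Algebra.orthogonal (q i) y" if "y \<in> q ` {..<Suc (Suc l)}" for y
        using that q(2) True il by (auto simp: Linear_Algebra.orthogonal_def orthonormal_family_def)
      ultimately have "Linear_Algebra.orthogonal (q i) (A *v q l)" using orthogonal_to_span by blast
      then show ?thesis using il by (auto simp: H_def Linear_Algebra.orthogonal_def)
    qed (use il in \<open>auto simp: H_def\<close>)
  qed
  have ex: "A *v q l = (\<Sum>i<m. H $$ (i, l) *\<^sub>R q i)" if l: "l < j" for l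
  proof -
    have "A *v q l \<in> span (q ` {..<m})"
      using Aq[OF l] krylov_mono[of "Suc (Suc l)" "Suc j" A v] l by (subst q(3)) (auto simp: Km)
    from orthonormal_family_expansion[OF q(2) this] show ?thesis using l jm by (auto simp: H_def intro!: sum.cong)
  qed
  have "arnoldi_decomposition A v j q H"
    unfolding arnoldi_decomposition_def
    using q hess ex jm by (auto simp: m_def H_def orthonormal_family_def split: if_splits)
  then show ?thesis by blast
qed

end

theory Submission
  imports Defs
begin

(* With V = span {q_1, ..., q_j}, the Gram matrix H^T H represents the quadratic form
   |A x|^2 on V in an orthonormal basis, so the extreme singular values of H are the maximum
   and the minimum of |A x| over the unit sphere of V.  The space K_{k-1}(A, A r_0) of
   RR-GMRES is contained in the space K_k(A, r_0) of GMRES, so its extrema are no further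
   apart. *)

section \<open>Extremal vectors of a quadratic form\<close>

text \<open>Along the line \<open>x + t *\<^sub>R y\<close> the form is a polynomial in
  \<open>t\<close> that is nonnegative and vanishes at \<open>t = 0\<close>, so its linear
  coefficient must vanish.\<close>

lemma psd_form_null_vector:
  fixes B :: "'a::real_vector \<Rightarrow> 'a \<Rightarrow> real"
  assumes quad: "\<And>t. B (x + t *\<^sub>R y) (x + t *\<^sub>R y) = B x x + 2 * t * B x y + t\<^sup>2 * B y y"
    and psd: "\<And>t. 0 \<le> B (x + t *\<^sub>R y) (x + t *\<^sub>R y)"
    and null: "B x x = 0"
  shows "B x y = 0"
proof (rule ccontr)
  assume ne: "B x y \<noteq> 0"
  \<comment> \<open>The polynomial is tested at \<open>t = - B x y / c\<close>. The natural
    denominator \<open>B y y\<close> may be zero; the positive \<open>c > B y y\<close> avoids this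
    and still makes the value negative.\<close>
  define c where "c = \<bar>B y y\<bar> + 1"
  have c: "c > 0" "B y y < c" by (auto simp: c_def)
  have "0 \<le> 2 * (- B x y / c) * B x y + (- B x y / c)\<^sup>2 * B y y"
    using psd[of "- B x y / c"] quad[of "- B x y / c"] null by simp
  also have "\<dots> = (B x y)\<^sup>2 / c * (B y y / c - 2)"
    using c by (simp add: field_simps power2_eq_square)
  finally have "0 \<le> (B x y)\<^sup>2 / c * (B y y / c - 2)" .
  moreover have "B y y / c - 2 < 0" using c by (simp add: field_simps)
  moreover have "(B x y)\<^sup>2 / c > 0" using ne c by simp
  ultimately show False by (meson mult_pos_neg not_less)
qed

text \<open>This is the Lagrange condition at an extremum of the Rayleigh quotient, an eigenvector
  equation tested against \<open>V\<close>. At an extremal \<open>x\<close> the difference of the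
  two sides of \<open>ext\<close> is a semidefinite form on \<open>V\<close> that vanishes at
  \<open>x\<close>, so \<open>psd_form_null_vector\<close> applies to its polarization
  \<open>B\<close>.\<close>

lemma stationary_if_extremal:
  fixes f :: "'a::real_inner \<Rightarrow> 'b::real_inner"
  assumes f: "linear f" and V: "subspace V" "x \<in> V" "y \<in> V" and x: "norm x = 1"
    and ext: "(\<forall>z\<in>V. (norm (f z))\<^sup>2 \<le> (norm (f x))\<^sup>2 * (norm z)\<^sup>2) \<or>
              (\<forall>z\<in>V. (norm (f x))\<^sup>2 * (norm z)\<^sup>2 \<le> (norm (f z))\<^sup>2)"
  shows "inner (f x) (f y) = (norm (f x))\<^sup>2 * inner x y"
proof -
  \<comment> \<open>The sign \<open>s\<close> is -1 at a maximum and 1 at a minimum, so that both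
    cases become one positive semidefinite form.\<close>
  obtain s :: real where s: "s \<noteq> 0"
    and psd: "\<And>z. z \<in> V \<Longrightarrow> 0 \<le> s * ((norm (f z))\<^sup>2 - (norm (f x))\<^sup>2 * (norm z)\<^sup>2)"
  proof (cases "\<forall>z\<in>V. (norm (f z))\<^sup>2 \<le> (norm (f x))\<^sup>2 * (norm z)\<^sup>2")
    case True
    then show ?thesis by (intro that[of "-1"]) auto
  next
    case False
    then show ?thesis using ext by (intro that[of 1]) auto
  qed
  define B where "B u v = s * (inner (f u) (f v) - (norm (f x))\<^sup>2 * inner u v)" for u v
  have "B x y = 0"
  proof (rule psd_form_null_vector[of B])
    fix t :: real
    show "B (x + t *\<^sub>R y) (x + t *\<^sub>R y) = B x x + 2 * t * B x y + t\<^sup>2 * B y y"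
      unfolding B_def
      by (simp add: linear_add[OF f] linear_scale[OF f] inner_add_left inner_add_right
          inner_commute[of y x] inner_commute[of "f y" "f x"] power2_eq_square algebra_simps)
    have "x + t *\<^sub>R y \<in> V" using V by (simp add: subspace_add subspace_scale)
    from psd[OF this] show "0 \<le> B (x + t *\<^sub>R y) (x + t *\<^sub>R y)"
      unfolding B_def by (simp add: dot_square_norm)
  next
    show "B x x = 0" using x unfolding B_def by (simp add: dot_square_norm)
  qed
  then show ?thesis using s by (simp add: B_def)
qed

text \<open>Compactness of the unit sphere of \<open>V\<close>, which is nonempty because of
  \<open>v\<close>, yields both extrema. The bounds are stated homogeneously, for all of
  \<open>V\<close>, to match the hypothesis \<open>ext\<close> of
  \<open>stationary_if_extremal\<close>.\<close>

lemma unit_sphere_extrema: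
  fixes f :: "'a::euclidean_space \<Rightarrow> 'b::euclidean_space"
  assumes f: "linear f" and V: "subspace V" "v \<in> V" "v \<noteq> 0"
  obtains x x' where "x \<in> V" "norm x = 1" "\<forall>z\<in>V. (norm (f z))\<^sup>2 \<le> (norm (f x))\<^sup>2 * (norm z)\<^sup>2"
    "x' \<in> V" "norm x' = 1" "\<forall>z\<in>V. (norm (f x'))\<^sup>2 * (norm z)\<^sup>2 \<le> (norm (f z))\<^sup>2"
proof -
  define S where "S = V \<inter> sphere 0 1"
  have S: "compact S" unfolding S_def
    by (intro closed_Int_compact closed_subspace V compact_sphere)
  have unit: "z /\<^sub>R norm z \<in> S" if "z \<in> V" "z \<noteq> 0" for z
    using that V by (simp add: S_def subspace_scale)
  have ne: "S \<noteq> {}" using unit V by blast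
  have cont: "continuous_on S (\<lambda>z. norm (f z))"
    by (intro continuous_on_norm linear_continuous_on) (simp add: f linear_linear)
  have scale: "norm (f z) = norm (f (z /\<^sub>R norm z)) * norm z" if "z \<noteq> 0" for z
    using that by (simp add: linear_scale[OF f])
  obtain x where x: "x \<in> S" "\<And>z. z \<in> S \<Longrightarrow> norm (f z) \<le> norm (f x)"
    using continuous_attains_sup[OF S ne cont] by blast
  obtain x' where x': "x' \<in> S" "\<And>z. z \<in> S \<Longrightarrow> norm (f x') \<le> norm (f z)"
    using continuous_attains_inf[OF S ne cont] by blast
  show ?thesis
  proof (rule that)
    show "x \<in> V" "norm x = 1" "x' \<in> V" "norm x' = 1" using x x' by (auto simp: S_def)
    show "\<forall>z\<in>V. (norm (f z))\<^sup>2 \<le> (norm (f x))\<^sup>2 * (norm z)\<^sup>2"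
    proof
      fix z assume z: "z \<in> V"
      show "(norm (f z))\<^sup>2 \<le> (norm (f x))\<^sup>2 * (norm z)\<^sup>2"
      proof (cases "z = 0")
        case False
        have "norm (f z) \<le> norm (f x) * norm z"
          unfolding scale[OF False] by (intro mult_right_mono x(2) unit z False) auto
        then show ?thesis by (metis norm_ge_zero power_mono power_mult_distrib)
      qed (simp add: linear_0[OF f])
    qed
    show "\<forall>z\<in>V. (norm (f x'))\<^sup>2 * (norm z)\<^sup>2 \<le> (norm (f z))\<^sup>2"
    proof
      fix z assume z: "z \<in> V"
      show "(norm (f x'))\<^sup>2 * (norm z)\<^sup>2 \<le> (norm (f z))\<^sup>2"
      proof (cases "z = 0")
        case False
        have "norm (f x') * norm z \<le> norm (f z)"
          unfolding scale[OF False] by (intro mult_right_mono x'(2) unit z False) auto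
        then show ?thesis by (metis norm_ge_zero mult_nonneg_nonneg power_mono power_mult_distrib)
      qed simp
    qed
  qed
qed

section \<open>Gram matrices and their eigenvalues\<close>

lemma inner_orthonormal_sums:
  assumes "orthonormal_family m q"
  shows "inner (\<Sum>i<m. c i *\<^sub>R q i) (\<Sum>i<m. d i *\<^sub>R q i) = (\<Sum>i<m. c i * d i)"
proof -
  have "inner (\<Sum>i<m. c i *\<^sub>R q i) (\<Sum>i<m. d i *\<^sub>R q i)
      = (\<Sum>i<m. \<Sum>l<m. c i * (d l * (if i = l then 1 else 0)))"
    using assms unfolding inner_sum_left inner_sum_right
    by (intro sum.cong) (auto simp: orthonormal_family_def)
  also have "\<dots> = (\<Sum>i<m. c i * d i)"
    by (simp add: if_distrib[of "(*) _"] sum.delta cong: if_cong)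
  finally show ?thesis .
qed

text \<open>An eigenvector \<open>w\<close> of \<open>G\<close> is read as the coordinates of a
  vector \<open>x\<close> in the basis \<open>q\<close>. Then |f x|^2 = w^T G w = \<mu> w^T w =
  \<mu> |x|^2, and it remains to normalize \<open>x\<close>.\<close>

lemma root_of_gram_char_poly:
  fixes f :: "real^'n \<Rightarrow> 'b::real_inner"
  assumes f: "linear f" and on: "orthonormal_family m q"
    and G: "G \<in> carrier_mat m m" "\<And>i l. i < m \<Longrightarrow> l < m \<Longrightarrow> G $$ (i, l) = inner (f (q i)) (f (q l))"
    and root: "poly (char_poly G) \<mu> = 0"
  shows "\<exists>x \<in> span (q ` {..<m}). norm x = 1 \<and> (norm (f x))\<^sup>2 = \<mu>"
proof -
  have "eigenvalue G \<mu>" using eigenvalue_root_char_poly[OF G(1)] root by blast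
  then obtain w where w: "w \<in> carrier_vec m" "w \<noteq> 0\<^sub>v m" "G *\<^sub>v w = \<mu> \<cdot>\<^sub>v w"
    unfolding eigenvalue_def eigenvector_def using G by auto
  define x where "x = (\<Sum>i<m. vec_index w i *\<^sub>R q i)"
  have Gw: "(\<Sum>l<m. inner (f (q i)) (f (q l)) * vec_index w l) = \<mu> * vec_index w i" if "i < m" for i
  proof -
    have "vec_index (G *\<^sub>v w) i = \<mu> * vec_index w i" using w that by simp
    then show ?thesis using that G w(1) by (simp add: scalar_prod_def lessThan_atLeast0)
  qed
  have xx: "(norm x)\<^sup>2 = (\<Sum>i<m. vec_index w i * vec_index w i)"
    unfolding x_def power2_norm_eq_inner by (rule inner_orthonormal_sums[OF on])
  have "f x = (\<Sum>i<m. vec_index w i *\<^sub>R f (q i))"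
    unfolding x_def by (simp add: linear_sum[OF f] linear_scale[OF f])
  then have "(norm (f x))\<^sup>2 = (\<Sum>i<m. vec_index w i * (\<Sum>l<m. inner (f (q i)) (f (q l)) * vec_index w l))"
    by (simp add: power2_norm_eq_inner inner_sum_left inner_sum_right sum_distrib_left
        inner_commute mult_ac)
  also have "\<dots> = \<mu> * (norm x)\<^sup>2"
    unfolding xx by (simp add: Gw sum_distrib_left[of \<mu>] mult.left_commute)
  finally have fx: "(norm (f x))\<^sup>2 = \<mu> * (norm x)\<^sup>2" .
  obtain i where i: "i < m" "vec_index w i \<noteq> 0" using w(1,2) by (metis carrier_vecD eq_vecI index_zero_vec)
  have "(\<Sum>i<m. vec_index w i * vec_index w i) > 0"
    using i by (intro sum_pos2[of _ i]) (auto simp: not_sum_squares_lt_zero zero_less_mult_iff)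
  then have x0: "x \<noteq> 0" using xx by auto
  have xV: "x \<in> span (q ` {..<m})" unfolding x_def by (intro span_sum span_scale span_base) auto
  show ?thesis
  proof (intro bexI conjI)
    show "x /\<^sub>R norm x \<in> span (q ` {..<m})" using xV by (rule span_scale)
    show "norm (x /\<^sub>R norm x) = 1" using x0 by simp
    show "(norm (f (x /\<^sub>R norm x)))\<^sup>2 = \<mu>"
      using x0 fx by (simp add: linear_scale[OF f] power_mult_distrib power_inverse field_simps)
  qed
qed

text \<open>Conversely, the coordinates of a stationary \<open>x\<close> form an eigenvector:
  choosing \<open>y = q i\<close> in \<open>stat\<close> gives row \<open>i\<close> of the
  eigenvalue equation.\<close>

lemma gram_char_poly_root:
  fixes f :: "real^'n \<Rightarrow> 'b::real_inner"
  assumes f: "linear f" and on: "orthonormal_family m q"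
    and G: "G \<in> carrier_mat m m" "\<And>i l. i < m \<Longrightarrow> l < m \<Longrightarrow> G $$ (i, l) = inner (f (q i)) (f (q l))"
    and x: "x \<in> span (q ` {..<m})" "x \<noteq> 0"
    and stat: "\<And>y. y \<in> span (q ` {..<m}) \<Longrightarrow> inner (f x) (f y) = \<mu> * inner x y"
  shows "poly (char_poly G) \<mu> = 0"
proof -
  define w where "w = Matrix.vec m (\<lambda>i. inner (q i) x)"
  have xw: "x = (\<Sum>i<m. inner (q i) x *\<^sub>R q i)" by (rule orthonormal_family_expansion[OF on x(1)])
  have w0: "w \<noteq> 0\<^sub>v m"
  proof
    assume "w = 0\<^sub>v m"
    then have "inner (q i) x = 0" if "i < m" for i
      using that by (metis index_vec index_zero_vec(1) w_def)
    then have "(\<Sum>i<m. inner (q i) x *\<^sub>R q i) = 0" by simp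
    then have "x = 0" using xw by metis
    then show False using x(2) by simp
  qed
  have fx: "f x = (\<Sum>i<m. inner (q i) x *\<^sub>R f (q i))"
    by (subst xw) (simp add: linear_sum[OF f] linear_scale[OF f])
  have "G *\<^sub>v w = \<mu> \<cdot>\<^sub>v w"
  proof (rule eq_vecI)
    fix i assume "i < dim_vec (\<mu> \<cdot>\<^sub>v w)"
    then have i: "i < m" by (simp add: w_def)
    have "vec_index (G *\<^sub>v w) i = (\<Sum>l<m. inner (f (q i)) (f (q l)) * inner (q l) x)"
      using i G by (simp add: scalar_prod_def w_def lessThan_atLeast0)
    also have "\<dots> = inner (f x) (f (q i))"
      unfolding fx inner_sum_left inner_scaleR_left
      by (intro sum.cong) (simp_all add: inner_commute mult.commute)
    also have "\<dots> = \<mu> * inner x (q i)" using i by (intro stat span_base) auto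
    finally show "vec_index (G *\<^sub>v w) i = vec_index (\<mu> \<cdot>\<^sub>v w) i" using i by (simp add: w_def inner_commute)
  qed (use G in \<open>simp add: w_def\<close>)
  then have "eigenvalue G \<mu>"
    unfolding eigenvalue_def eigenvector_def using w0 G by (intro exI[of _ w]) (auto simp: w_def)
  then show ?thesis using eigenvalue_root_char_poly[OF G(1)] by blast
qed

section \<open>Singular values of an Arnoldi matrix\<close>

lemma set_singular_values:
  "set (singular_values M) = sqrt ` {\<mu>. poly (char_poly (transpose_mat M * M)) \<mu> = 0}"
proof -
  have "transpose_mat M * M \<in> carrier_mat (dim_col M) (dim_col M)" by auto
  \<comment> \<open>Since the characteristic polynomial is monic, it is nonzero, so the elements of
    \<open>proots\<close> are exactly its roots.\<close>
  then have "char_poly (transpose_mat M * M) \<noteq> 0"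
    by (metis coeff_0 degree_monic_char_poly zero_neq_one)
  then show ?thesis by (simp add: singular_values_def)
qed

lemma singular_values_bounds:
  assumes "s \<in> set (singular_values M)"
  shows "s \<le> singular_values M ! 0" "singular_values M ! (dim_col M - 1) \<le> s"
proof -
  obtain i where i: "i < dim_col M" "s = singular_values M ! i"
    using assms by (metis in_set_conv_nth length_singular_values)
  have "sorted (rev (singular_values M))" by (simp add: singular_values_def)
  then have desc: "singular_values M ! b \<le> singular_values M ! a" if "a \<le> b" "b < dim_col M" for a b
    using that by (simp add: sorted_rev_nth_mono length_singular_values)
  show "s \<le> singular_values M ! 0" "singular_values M ! (dim_col M - 1) \<le> s"
    unfolding i(2) using i(1) by (auto intro!: desc)
qed

text \<open>Column \<open>l\<close> of \<open>H\<close> holds the coordinates of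
  \<open>A *v q l\<close> in an orthonormal family, so inner products of columns are inner products
  of the images.\<close>

lemma gram_of_arnoldi:
  assumes "arnoldi_decomposition A v j q H" and i: "i < j" and l: "l < j"
  shows "(transpose_mat H * H) $$ (i, l) = inner (A *v q i) (A *v q l)"
proof -
  have H: "H \<in> carrier_mat (j + 1) j" using assms(1) by (simp add: arnoldi_decomposition_def)
  have HH: "(transpose_mat H * H) $$ (i, l) = (\<Sum>a<j + 1. H $$ (a, i) * H $$ (a, l))"
    using H i l by (simp add: scalar_prod_def lessThan_atLeast0)
  show ?thesis
  proof (cases "dim (krylov A v (j + 1)) = j + 1")
    case True
    then have on: "orthonormal_family (j + 1) q"
      and Aq: "\<And>l. l < j \<Longrightarrow> A *v q l = (\<Sum>i<j + 1. H $$ (i, l) *\<^sub>R q i)"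
      using assms(1) unfolding arnoldi_decomposition_def by simp_all
    show ?thesis unfolding HH Aq[OF i] Aq[OF l] by (rule inner_orthonormal_sums[OF on, symmetric])
  next
    case False
    then have on: "orthonormal_family j q" and H0: "\<And>l. l < j \<Longrightarrow> H $$ (j, l) = 0"
      and Aq: "\<And>l. l < j \<Longrightarrow> A *v q l = (\<Sum>i<j. H $$ (i, l) *\<^sub>R q i)"
      using assms(1) unfolding arnoldi_decomposition_def by simp_all
    \<comment> \<open>In the breakdown case only \<open>j\<close> vectors are orthonormal; the zero
      last row removes the summand with index \<open>j\<close> from \<open>HH\<close>.\<close>
    show ?thesis unfolding HH Aq[OF i] Aq[OF l] inner_orthonormal_sums[OF on] using H0[OF i] by simp
  qed
qed

text \<open>Every singular value is attained as \<open>norm (A *v x)\<close> at a unit vector of the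
  Krylov space. In the other direction, the maximum and the minimum of this norm occur at stationary
  vectors and are therefore singular values, so the first and last entries of the decreasing list
  bound them.\<close>

lemma arnoldi_singular_values_extremal:
  assumes arn: "arnoldi_decomposition A v j q H" and j: "0 < j"
  defines "\<sigma> \<equiv> singular_values H"
  shows "\<exists>x\<in>krylov A v j. norm x = 1 \<and> norm (A *v x) = \<sigma> ! 0"
    and "\<exists>x\<in>krylov A v j. norm x = 1 \<and> norm (A *v x) = \<sigma> ! (j - 1)"
    and "\<And>x. x \<in> krylov A v j \<Longrightarrow> norm x = 1 \<Longrightarrow>
           \<sigma> ! (j - 1) \<le> norm (A *v x) \<and> norm (A *v x) \<le> \<sigma> ! 0"
proof -
  define G where "G = transpose_mat H * H"
  have H: "dim_col H = j" and on: "orthonormal_family j q" and K: "span (q ` {..<j}) = krylov A v j"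
    using arn by (auto simp: arnoldi_decomposition_def)
  have G: "G \<in> carrier_mat j j" using H by (auto simp: G_def)
  have Gq: "\<And>i l. i < j \<Longrightarrow> l < j \<Longrightarrow> G $$ (i, l) = inner (A *v q i) (A *v q l)"
    unfolding G_def by (rule gram_of_arnoldi[OF arn])
  have lin: "linear ((*v) A)" by simp
  have attained: "\<exists>x\<in>krylov A v j. norm x = 1 \<and> norm (A *v x) = \<sigma> ! i" if "i < j" for i
  proof -
    have "\<sigma> ! i \<in> set \<sigma>" using that H by (simp add: \<sigma>_def length_singular_values)
    then obtain \<mu> where l: "\<sigma> ! i = sqrt \<mu>" "poly (char_poly G) \<mu> = 0"
      unfolding \<sigma>_def set_singular_values G_def by auto
    from root_of_gram_char_poly[OF lin on G Gq l(2)] show ?thesis unfolding K l(1) by force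
  qed
  show "\<exists>x\<in>krylov A v j. norm x = 1 \<and> norm (A *v x) = \<sigma> ! 0"
    "\<exists>x\<in>krylov A v j. norm x = 1 \<and> norm (A *v x) = \<sigma> ! (j - 1)"
    using j by (auto intro!: attained)
  have V: "subspace (krylov A v j)" unfolding K[symmetric] by simp
  \<comment> \<open>The unit vector attaining a singular value shows that the Krylov space is
    nontrivial, as \<open>unit_sphere_extrema\<close> requires.\<close>
  obtain v0 where v0: "v0 \<in> krylov A v j" "v0 \<noteq> 0" using attained[OF j] by force
  have stationary: "norm (A *v x) \<in> set \<sigma>" if x: "x \<in> krylov A v j" "norm x = 1"
    and ext: "(\<forall>z\<in>krylov A v j. (norm (A *v z))\<^sup>2 \<le> (norm (A *v x))\<^sup>2 * (norm z)\<^sup>2) \<or>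
              (\<forall>z\<in>krylov A v j. (norm (A *v x))\<^sup>2 * (norm z)\<^sup>2 \<le> (norm (A *v z))\<^sup>2)" for x
  proof -
    have "poly (char_poly G) ((norm (A *v x))\<^sup>2) = 0"
    proof (rule gram_char_poly_root[OF lin on G Gq])
      show "x \<in> span (q ` {..<j})" "x \<noteq> 0" using x K by auto
    qed (use stationary_if_extremal[OF lin V x(1) _ x(2) ext] K in auto)
    then show ?thesis unfolding \<sigma>_def set_singular_values G_def
      by (intro image_eqI[of _ _ "(norm (A *v x))\<^sup>2"]) auto
  qed
  obtain x x' where x: "x \<in> krylov A v j" "norm x = 1"
      "\<forall>z\<in>krylov A v j. (norm (A *v z))\<^sup>2 \<le> (norm (A *v x))\<^sup>2 * (norm z)\<^sup>2"
    and x': "x' \<in> krylov A v j" "norm x' = 1"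
      "\<forall>z\<in>krylov A v j. (norm (A *v x'))\<^sup>2 * (norm z)\<^sup>2 \<le> (norm (A *v z))\<^sup>2"
    using unit_sphere_extrema[OF lin V v0] by metis
  \<comment> \<open>Both extreme norms lie in \<open>set \<sigma>\<close>, so
    \<open>singular_values_bounds\<close> applies to them.\<close>
  have up: "norm (A *v x) \<le> \<sigma> ! 0" and low: "\<sigma> ! (j - 1) \<le> norm (A *v x')"
    using singular_values_bounds[of _ H] stationary[OF x(1,2)] x(3) stationary[OF x'(1,2)] x'(3) H
    unfolding \<sigma>_def by auto
  fix z assume z: "z \<in> krylov A v j" "norm z = 1"
  have "norm (A *v z) \<le> norm (A *v x)" "norm (A *v x') \<le> norm (A *v z)"
    using x(3) x'(3) z by (auto intro: power2_le_imp_le)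
  then show "\<sigma> ! (j - 1) \<le> norm (A *v z) \<and> norm (A *v z) \<le> \<sigma> ! 0" using up low by linarith
qed

section \<open>Comparison of nested Krylov spaces\<close>

lemma krylov_image_subset: "krylov A (A *v v) j \<subseteq> krylov A v (Suc j)"
  unfolding krylov_def
proof (intro span_mono, clarsimp)
  fix i assume "i < j"
  then show "((*v) A ^^ i) (A *v v) \<in> (\<lambda>i. ((*v) A ^^ i) v) ` {..<Suc j}"
    by (intro image_eqI[of _ _ "Suc i"]) (auto simp: funpow_Suc_right simp del: funpow.simps)
qed

text \<open>Passing to a smaller space can only lower the maximum and raise the minimum of
  \<open>norm (A *v x)\<close> over unit vectors, so the quotient does not grow.\<close>

lemma condition_number_arnoldi_mono:
  assumes arn: "arnoldi_decomposition A v j q H" and arn': "arnoldi_decomposition A v' j' q' H'"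
    and j: "0 < j" "0 < j'" and sub: "krylov A v' j' \<subseteq> krylov A v j"
  shows "condition_number H' \<le> condition_number H"
proof -
  let ?s = "singular_values H" and ?s' = "singular_values H'"
  note ex = arnoldi_singular_values_extremal[OF arn j(1)]
  note ex' = arnoldi_singular_values_extremal[OF arn' j(2)]
  have cols: "dim_col H = j" "dim_col H' = j'"
    using arn arn' by (auto simp: arnoldi_decomposition_def)
  have max_le: "?s' ! 0 \<le> ?s ! 0" and min_ge: "?s ! (j - 1) \<le> ?s' ! (j' - 1)"
    using ex'(1,2) ex(3) sub by (metis subsetD)+
  have nonneg: "0 \<le> ?s ! 0" "0 \<le> ?s ! (j - 1)"
    using ex(1,2) by (metis norm_ge_zero)+
  show ?thesis
  \<comment> \<open>If the smallest singular value of \<open>H\<close> is zero, the right-hand side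
    is infinite. Otherwise \<open>min_ge\<close> makes that of \<open>H'\<close> positive too, and
    both condition numbers are finite quotients.\<close>
  proof (cases "?s ! (j - 1) = 0")
    case True
    then show ?thesis by (simp add: condition_number_def cols)
  next
    case False
    then have "0 < ?s ! (j - 1)" using nonneg by simp
    then show ?thesis
      using frac_le[OF nonneg(1) max_le _ min_ge] min_ge by (simp add: condition_number_def cols)
  qed
qed

theorem mainTheorem6:
  fixes A :: "real^'n^'n" and b x\<^sub>0 r\<^sub>0 :: "real^'n" and k :: nat
    and q q\<^sub>R :: "nat \<Rightarrow> real^'n" and H H\<^sub>R :: "real mat"
  assumes r0: "r\<^sub>0 = b - A *v x\<^sub>0"
    and k: "k \<in> {2..CARD('n) - 1}"
    and dim: "dim (krylov A r\<^sub>0 k) = k"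
    and GMRES: "arnoldi_decomposition A r\<^sub>0 k q H"
    and RR_GMRES: "arnoldi_decomposition A (A *v r\<^sub>0) (k - 1) q\<^sub>R H\<^sub>R"
  shows "condition_number H\<^sub>R \<le> condition_number H"
proof (rule condition_number_arnoldi_mono[OF GMRES RR_GMRES])
  \<comment> \<open>The bound \<open>k \<ge> 2\<close> ensures that the RR-GMRES matrix has at least
    one column.\<close>
  show "0 < k" "0 < k - 1" using k by auto
  then show "krylov A (A *v r\<^sub>0) (k - 1) \<subseteq> krylov A r\<^sub>0 k"
    using krylov_image_subset[of A r\<^sub>0 "k - 1"] by simp
qed

end
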